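(* For positive integers $a,b,c$ with $a \le b \le c$, we have $$N(abc) \ge \min\{N(a)+1,\,N(b),\,N(c)\},$$ where $N(n)$ denotes the maximum number of mutually orthogonal latin squares of order $n$.
   Context: A latin square of order $n$ is an $n\times n$ array with entries from an $n$-element symbol set such that each row and each column contains every symbol exactly once. Two latin squares $L=(L_{ij})$ and $M=(M_{ij})$ of order $n$ are orthogonal if the $n^2$ ordered pairs $(L_{ij},M_{ij})$, $1\le i,j\le n$, are all distinct. A family of pairwise orthogonal latin squares is called mutually orthogonal latin squares (MOLS). $N(n)$ is the maximum size of a family of MOLS of order $n$ (with the standard convention that $N(1)=\infty$). *)

theory Defs
  imports Complex_Main "HOL-Library.Extended_Nat"
begin

text \<open>Rows and columns are indexed by \<open>{..<n}\<close>; symbols are natural numbers, and any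
  \<open>n\<close>-element set of them may serve as the symbol set.\<close>

definition latin_square :: "nat \<Rightarrow> (nat \<Rightarrow> nat \<Rightarrow> nat) \<Rightarrow> bool" where
  "latin_square n L \<longleftrightarrow>
     (\<exists>S. finite S \<and> card S = n \<and>
          (\<forall>i<n. bij_betw (\<lambda>j. L i j) {..<n} S) \<and>
          (\<forall>j<n. bij_betw (\<lambda>i. L i j) {..<n} S))"

definition orthogonal_squares :: "nat \<Rightarrow> (nat \<Rightarrow> nat \<Rightarrow> nat) \<Rightarrow> (nat \<Rightarrow> nat \<Rightarrow> nat) \<Rightarrow> bool" where
  "orthogonal_squares n L M \<longleftrightarrow> inj_on (\<lambda>(i, j). (L i j, M i j)) ({..<n} \<times> {..<n})"

text \<open>A family is indexed, so members with different indices may coincide. As no latin square of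
  order at least 2 is orthogonal to itself, repetition is possible only for order 1 (and 0).\<close>

definition MOLS :: "nat \<Rightarrow> nat \<Rightarrow> (nat \<Rightarrow> nat \<Rightarrow> nat \<Rightarrow> nat) \<Rightarrow> bool" where
  "MOLS n k F \<longleftrightarrow>
     (\<forall>t<k. latin_square n (F t)) \<and>
     (\<forall>s<k. \<forall>t<k. s \<noteq> t \<longrightarrow> orthogonal_squares n (F s) (F t))"

text \<open>For \<open>n \<ge> 2\<close> the supremum is a maximum (\<open>max_MOLS_attained\<close>), and for \<open>n = 1\<close> it is
  infinite (\<open>max_MOLS_1\<close>), in agreement with the usual convention.\<close>

definition max_MOLS :: "nat \<Rightarrow> enat" where
  "max_MOLS n = Sup {enat k | k. \<exists>F. MOLS n k F}"

lemma max_MOLS_1: "max_MOLS 1 = \<infinity>"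
proof -
  have "MOLS 1 k (\<lambda>_ _ _. 0)" for k
    by (auto simp: MOLS_def latin_square_def orthogonal_squares_def bij_betw_def inj_on_def
        intro!: exI[of _ "{0}"])
  hence *: "{enat k | k. \<exists>F. MOLS 1 k F} = range enat" by auto
  have "infinite (range enat)"
    by (simp add: finite_image_iff inj_on_def)
  thus ?thesis
    unfolding max_MOLS_def * by (auto simp: Sup_enat_def)
qed

lemma MOLS_bound:
  assumes "n \<ge> 2" "MOLS n k F"
  shows "k \<le> n - 1"
proof -
  have "\<exists>j. j \<in> {1..<n} \<and> F t 1 j = F t 0 0" if t: "t < k" for t
  proof -
    from t assms(2) obtain S where
      S: "\<forall>i<n. bij_betw (\<lambda>j. F t i j) {..<n} S" "\<forall>j<n. bij_betw (\<lambda>i. F t i j) {..<n} S"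
      unfolding MOLS_def latin_square_def by blast
    have "F t 0 0 \<in> S" using bij_betwE[of "\<lambda>j. F t 0 j" "{..<n}" S] S(1) assms(1) by auto
    also have "S = (\<lambda>j. F t 1 j) ` {..<n}" using S(1) assms(1) by (auto simp: bij_betw_def)
    finally obtain j where j: "j < n" "F t 1 j = F t 0 0" by auto
    have "inj_on (\<lambda>i. F t i 0) {..<n}" using S(2) assms(1) by (auto simp: bij_betw_def)
    hence "F t 1 0 \<noteq> F t 0 0" using assms(1) inj_onD[of "\<lambda>i. F t i 0" "{..<n}" 1 0] by auto
    with j have "j \<noteq> 0" by metis
    with j show ?thesis by (intro exI[of _ j]) auto
  qed
  then obtain f where f: "\<And>t. t < k \<Longrightarrow> f t \<in> {1..<n} \<and> F t 1 (f t) = F t 0 0" by metis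
  have "inj_on f {..<k}"
  proof (rule inj_onI, rule ccontr)
    fix s t assume st: "s \<in> {..<k}" "t \<in> {..<k}" "f s = f t" "s \<noteq> t"
    hence "orthogonal_squares n (F s) (F t)" using assms(2) by (auto simp: MOLS_def)
    moreover have "F s 1 (f t) = F s 0 0" "F t 1 (f t) = F t 0 0" "f t < n"
      using f[of s] f[of t] st by auto
    ultimately have "(1::nat, f t) = (0, 0)"
      unfolding orthogonal_squares_def using assms(1) by (elim inj_onD) auto
    thus False by simp
  qed
  moreover have "f ` {..<k} \<subseteq> {1..<n}" using f by auto
  ultimately have "card {..<k} \<le> card {1..<n}" by (rule card_inj_on_le) simp
  thus ?thesis by simp
qed

lemma max_MOLS_attained:
  assumes "n \<ge> 2"
  shows "\<exists>k F. max_MOLS n = enat k \<and> MOLS n k F \<and> (\<forall>k' F'. MOLS n k' F' \<longrightarrow> k' \<le> k)"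
proof -
  let ?P = "\<lambda>k. \<exists>F. MOLS n k F"
  have P0: "?P 0" by (simp add: MOLS_def)
  have bd: "\<forall>y. ?P y \<longrightarrow> y \<le> n - 1" using MOLS_bound[OF assms] by blast
  define k where "k = (GREATEST k. ?P k)"
  have k: "?P k" unfolding k_def by (rule GreatestI_nat[where P = ?P, OF P0]) (use bd in blast)
  have le: "k' \<le> k" if "?P k'" for k'
    unfolding k_def by (rule Greatest_le_nat[where P = ?P, OF that]) (use bd in blast)
  have "max_MOLS n = enat k"
    unfolding max_MOLS_def
    by (rule antisym) (use k in \<open>auto intro!: Sup_least Sup_upper le\<close>)
  with k le show ?thesis by blast
qed

end

theory Submission
  imports Defs
begin

text \<open>
  Let \<open>k + 1\<close> be at most the minimum. The \<open>k\<close> squares \<open>A\<^sub>i\<close> of order \<open>a\<close>, together with the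
  column index, give \<open>k + 1\<close> arrays \<open>X\<^sub>i(p, w)\<close> any two of which determine \<open>(p, w)\<close>, and which are
  injective in \<open>w\<close> for fixed \<open>p\<close>. The plain product \<open>(X\<^sub>i(p, w), B\<^sub>i(j, j'), C\<^sub>i(l', l))\<close> has
  \<open>k + 1\<close> pairwise orthogonal components, but it still has to be laid out as a square: rows and
  columns are two further parallel classes, which \<open>X\<close> alone does not supply. Take the rows to be
  pairs \<open>(t, l')\<close> and the columns pairs \<open>(u, j')\<close>, where \<open>t\<close> ranges over \<open>a b\<close> and \<open>u\<close> over \<open>a c\<close>
  values, and make \<open>(p, w, j, l)\<close> a bijective function of the cell \<open>(t, u)\<close>. The result is a latin
  square as soon as \<open>(t, l)\<close> determines \<open>p\<close> and \<open>(t, l, w)\<close> determines \<open>u\<close>, and likewise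
  \<open>(u, j)\<close> determines \<open>p\<close> and \<open>(u, j, w)\<close> determines \<open>t\<close>.

  Such a cell design exists for \<open>a \<le> b\<close> and \<open>2 \<le> c\<close>. It is additive in \<open>b\<close>, so let \<open>b = a + r\<close>
  with \<open>r \<le> a\<close>. Take the values \<open>t\<close> to be the \<open>a\<^sup>2\<close> points of a grid and \<open>a r\<close> extra points, \<open>r\<close>
  for each \<open>p\<close>, and associate with each \<open>l\<close> a parallel class of \<open>a\<close> lines of the grid, the classes
  of cyclically consecutive \<open>l\<close> being transversal. The column \<open>u = (l, m)\<close> is cut into sets of \<open>a\<close>
  points: \<open>r\<close> full lines of the class of \<open>l + 1\<close>, and for each line of the class of \<open>l\<close> what remains
  of it together with its \<open>r\<close> extra points. Which lines are taken, and the values of \<open>w\<close>, are read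
  off a latin square of order \<open>a + r\<close> with a hole of size \<open>r\<close>.
\<close>

section \<open>Latin squares with a hole\<close>

text \<open>The hole consists of the cells \<open>(x, y)\<close> with \<open>a \<le> x\<close> and \<open>a \<le> y\<close>, on which \<open>S\<close> is not
  constrained; the symbols missing from the hole's rows and columns are \<open>a, \<dots>, a + r - 1\<close>.\<close>

definition incomplete_latin_square :: "nat \<Rightarrow> nat \<Rightarrow> (nat \<Rightarrow> nat \<Rightarrow> nat) \<Rightarrow> bool" where
  "incomplete_latin_square a r S \<longleftrightarrow>
     (\<forall>x<a. \<forall>y<a. S x y < a + r) \<and>
     (\<forall>x<a. \<forall>y. a \<le> y \<longrightarrow> y < a + r \<longrightarrow> S x y < a) \<and>
     (\<forall>x y. a \<le> x \<longrightarrow> x < a + r \<longrightarrow> y < a \<longrightarrow> S x y < a) \<and>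
     (\<forall>x<a. inj_on (S x) {..<a + r}) \<and>
     (\<forall>x. a \<le> x \<longrightarrow> x < a + r \<longrightarrow> inj_on (S x) {..<a}) \<and>
     (\<forall>y<a. inj_on (\<lambda>x. S x y) {..<a + r}) \<and>
     (\<forall>y. a \<le> y \<longrightarrow> y < a + r \<longrightarrow> inj_on (\<lambda>x. S x y) {..<a})"

definition sub_mod :: "nat \<Rightarrow> nat \<Rightarrow> nat \<Rightarrow> nat" where
  "sub_mod a x y = nat ((int x - int y) mod int a)"

lemma sub_mod_less: "0 < a \<Longrightarrow> sub_mod a x y < a"
  by (simp add: sub_mod_def nat_less_iff)

lemma sub_mod_eq_iff:
  "0 < a \<Longrightarrow> sub_mod a x y = sub_mod a x' y' \<longleftrightarrow>
     (int x - int y) mod int a = (int x' - int y') mod int a"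
  by (simp add: sub_mod_def nat_eq_iff)

lemma int_mod_less_eqD:
  assumes "(int x - int y) mod int a = 0" "x < a" "y < a"
  shows "x = y"
proof -
  have "int x mod int a = int y mod int a"
    using assms(1) by (simp add: mod_eq_dvd_iff dvd_eq_mod_eq_0)
  then show ?thesis using assms(2,3) by (simp flip: zmod_int)
qed

lemma sub_mod_left_cancel:
  assumes "sub_mod a x y = sub_mod a x y'" "y < a" "y' < a"
  shows "y = y'"
proof -
  have "(int x - int y) mod int a = (int x - int y') mod int a"
    using assms sub_mod_eq_iff[of a] by auto
  then have "int a dvd (int x - int y) - (int x - int y')"
    by (simp only: mod_eq_dvd_iff)
  then have "(int y' - int y) mod int a = 0" by simp
  with int_mod_less_eqD assms(2,3) show ?thesis by metis
qed

lemma sub_mod_right_cancel: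
  assumes "sub_mod a x y = sub_mod a x' y" "x < a" "x' < a"
  shows "x = x'"
proof -
  have "(int x - int y) mod int a = (int x' - int y) mod int a"
    using assms sub_mod_eq_iff[of a] by auto
  then have "int a dvd (int x - int y) - (int x' - int y)"
    by (simp only: mod_eq_dvd_iff)
  then have "(int x - int x') mod int a = 0" by simp
  with int_mod_less_eqD assms(2,3) show ?thesis by metis
qed

text \<open>With \<open>s = \<sigma> t\<close> and \<open>b = \<beta> s\<close> for the difference
  \<open>t\<close> of \<open>y\<close> and \<open>x\<close>, an inner symbol can be read off its
  column as well as its row.\<close>

lemma sub_mod_diff:
  assumes "0 < a" and "b = (s + sub_mod a y x) mod a"
  shows "sub_mod a x s = sub_mod a y b"
proof -
  have b: "int b = (int s + (int y - int x) mod int a) mod int a"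
    using assms by (simp add: sub_mod_def zmod_int)
  have "(int y - int b) mod int a = (int y - (int s + (int y - int x))) mod int a"
    unfolding b by (metis mod_add_right_eq mod_diff_right_eq)
  also have "int y - (int s + (int y - int x)) = int x - int s" by simp
  finally show ?thesis using assms(1) by (simp add: sub_mod_def)
qed

lemma add_mod_cancel:
  assumes "(x + m) mod a = (y + m) mod a" "x < a" "y < a"
  shows "x = (y::nat)"
proof -
  have "int a dvd int (x + m) - int (y + m)"
    using assms(1) by (metis mod_eq_dvd_iff zmod_int)
  then have "(int x - int y) mod int a = 0" by simp
  with int_mod_less_eqD assms(2,3) show ?thesis by metis
qed

text \<open>Multiplication by 2 is an orthomorphism of the integers modulo an odd number; for even
  modulus, where none exists, one value of the difference \<open>t\<close> has to be given up.\<close>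

lemma near_orthomorphism_exists:
  assumes "0 < r" "r \<le> a"
  shows "\<exists>\<sigma> \<beta>. (\<forall>t<a. \<sigma> t < a) \<and> inj_on \<sigma> {..<a} \<and> (\<forall>s<a. \<beta> s < a) \<and> inj_on \<beta> {..<a} \<and>
     (\<forall>t<a. \<sigma> t < a - r \<longrightarrow> \<beta> (\<sigma> t) = (\<sigma> t + t) mod (a::nat))"
proof -
  define h where "h = (a + 1) div 2"
  \<comment> \<open>\<open>\<beta>\<close> doubles modulo \<open>a\<close>, its second half being
    moved to the odd values if \<open>a\<close> is even. In the even case the difference
    \<open>h\<close> is sacrificed: \<open>\<sigma>\<close> sends it to \<open>a - 1\<close>,
    outside \<open>\<sigma> t < a - r\<close>, and later differences move down by one.\<close>
  define \<beta> where "\<beta> = (\<lambda>s. if s < h then 2 * s else 2 * (s - h) + 1)"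
  define \<sigma> where "\<sigma> = (\<lambda>t. if odd a \<or> t < h then t else if t = h then a - 1 else t - 1)"
  have a: "odd a \<and> a + 1 = 2 * h \<or> even a \<and> a = 2 * h" unfolding h_def by presburger
  have \<beta>: "\<forall>s<a. \<beta> s < a" "inj_on \<beta> {..<a}"
    using a unfolding \<beta>_def inj_on_def by (auto split: if_splits; presburger)+
  have \<sigma>: "\<forall>t<a. \<sigma> t < a" "inj_on \<sigma> {..<a}"
    using a unfolding \<sigma>_def inj_on_def by (auto split: if_splits)
  have "\<beta> (\<sigma> t) = (\<sigma> t + t) mod a" if t: "t < a" "\<sigma> t < a - r" for t
  proof (cases "\<sigma> t < h")
    case True
    then have "\<sigma> t = t \<and> 2 * t < a" using a t assms unfolding \<sigma>_def by (auto split: if_splits)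
    then show ?thesis using True by (simp add: \<beta>_def mult_2)
  next
    case False
    then have "\<sigma> t + t = 2 * (\<sigma> t - h) + 1 + a" and "2 * (\<sigma> t - h) + 1 < a"
      using a t assms unfolding \<sigma>_def by (auto split: if_splits)
    then show ?thesis using False by (simp only: \<beta>_def if_False mod_add_self2 mod_less)
  qed
  with \<beta> \<sigma> show ?thesis by blast
qed

text \<open>For \<open>0 < r\<close> this is a prolongation: on the diagonal
  \<open>y - x = t\<close> the entries \<open>x - \<sigma> t\<close> modulo \<open>a\<close> are
  distinct. The \<open>r\<close> diagonals with \<open>a - r \<le> \<sigma> t\<close> pass these
  entries to the border columns and become constant, with a new symbol each.\<close>

lemma incomplete_latin_square_exists:
  assumes "0 < a" "r \<le> a"
  shows "\<exists>S. incomplete_latin_square a r S"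
proof (cases "r = 0")
  case True
  have "incomplete_latin_square a 0 (\<lambda>x y. (x + y) mod a)"
    using assms unfolding incomplete_latin_square_def inj_on_def
    by (auto dest: add_mod_cancel) (metis add.commute add_mod_cancel)
  with True show ?thesis by blast
next
  case False
  then obtain \<sigma> \<beta> where \<sigma>: "\<And>t. t < a \<Longrightarrow> \<sigma> t < a" "inj_on \<sigma> {..<a}"
    and \<beta>: "\<And>s. s < a \<Longrightarrow> \<beta> s < a" "inj_on \<beta> {..<a}"
    and \<sigma>\<beta>: "\<And>t. t < a \<Longrightarrow> \<sigma> t < a - r \<Longrightarrow> \<beta> (\<sigma> t) = (\<sigma> t + t) mod a"
    using near_orthomorphism_exists[of r a] assms by auto
  \<comment> \<open>The symbol \<open>i < a\<close> occupies the cells \<open>(s + i, \<beta> s + i)\<close> modulo \<open>a\<close> for \<open>s < a - r\<close>; the rows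
    \<open>s + i\<close> and columns \<open>\<beta> s + i\<close> it misses, \<open>a - r \<le> s\<close>, are served outside the \<open>a\<close> by \<open>a\<close> part.\<close>
  define q where "q = (\<lambda>x y. \<sigma> (sub_mod a y x))"
  define S where "S = (\<lambda>x y.
    if x < a then if y < a then if q x y < a - r then sub_mod a x (q x y) else q x y + r
                  else sub_mod a x (y - r)
    else sub_mod a y (\<beta> (x - r)))"
  note lt = sub_mod_less[OF assms(1)]
  have q: "q x y < a" for x y unfolding q_def by (intro \<sigma> lt)
  have q_row: "y = y'" if "q x y = q x y'" "y < a" "y' < a" for x y y'
    using that \<sigma>(2) lt unfolding q_def by (auto dest!: inj_onD intro: sub_mod_right_cancel)
  have q_col: "x = x'" if "q x y = q x' y" "x < a" "x' < a" for x x' y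
    using that \<sigma>(2) lt unfolding q_def by (auto dest!: inj_onD intro: sub_mod_left_cancel)
  have q_\<beta>: "sub_mod a x (q x y) = sub_mod a y (\<beta> (q x y))" if "q x y < a - r" for x y
    using that \<sigma>\<beta>[OF lt] assms(1) unfolding q_def by (intro sub_mod_diff) auto
  have \<beta>_eq: "s = s'" if "sub_mod a y (\<beta> s) = sub_mod a y (\<beta> s')" "s < a" "s' < a" for y s s'
    using that \<beta> by (metis inj_onD lessThan_iff sub_mod_left_cancel)
  have row1: "inj_on (S x) {..<a + r}" if x: "x < a" for x
  proof -
    \<comment> \<open>Values from \<open>a - r\<close> on are taken twice, at an inner cell with a
      symbol at least \<open>a\<close> and at a border cell with a smaller one.\<close>
    define s where "s = (\<lambda>y. if y < a then q x y else y - r)"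
    have S: "S x y = (if y < a \<and> a - r \<le> s y then s y + r else sub_mod a x (s y))" for y
      using x by (auto simp: S_def s_def)
    have s: "s y < a" if "y < a + r" for y using that q assms by (auto simp: s_def)
    have "y = y'" if y: "y < a + r" "y' < a + r" "S x y = S x y'" for y y'
    proof -
      have "s y = s y' \<and> (y < a \<and> a - r \<le> s y \<longleftrightarrow> y' < a \<and> a - r \<le> s y')"
        using y(3) s[OF y(1)] s[OF y(2)] lt[of x "s y"] lt[of x "s y'"]
          sub_mod_left_cancel[of a x "s y" "s y'"] assms(2)
        unfolding S by (simp split: if_splits; blast)
      then show ?thesis using y assms(2) by (auto simp: s_def split: if_splits dest: q_row)
    qed
    then show ?thesis by (auto intro!: inj_onI)
  qed
  have col: "inj_on (\<lambda>x. S x y) {..<a + r}" if y: "y < a" for y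
  proof -
    define s where "s = (\<lambda>x. if x < a then q x y else x - r)"
    have S: "S x y = (if x < a \<and> a - r \<le> s x then s x + r else sub_mod a y (\<beta> (s x)))" for x
      using y q_\<beta> by (auto simp: S_def s_def)
    have s: "s x < a" if "x < a + r" for x using that q assms by (auto simp: s_def)
    have "x = x'" if x: "x < a + r" "x' < a + r" "S x y = S x' y" for x x'
    proof -
      have "s x = s x' \<and> (x < a \<and> a - r \<le> s x \<longleftrightarrow> x' < a \<and> a - r \<le> s x')"
        using x(3) s[OF x(1)] s[OF x(2)] lt[of y "\<beta> (s x)"] lt[of y "\<beta> (s x')"]
          \<beta>_eq[of y "s x" "s x'"] assms(2)
        unfolding S by (simp split: if_splits; blast)
      then show ?thesis using x assms(2) by (auto simp: s_def split: if_splits dest: q_col)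
    qed
    then show ?thesis by (auto intro!: inj_onI)
  qed
  have row2: "inj_on (S x) {..<a}" if "a \<le> x" for x
    using that by (auto simp: S_def intro!: inj_onI dest: sub_mod_right_cancel)
  have col2: "inj_on (\<lambda>x. S x y) {..<a}" if "a \<le> y" for y
    using that by (auto simp: S_def intro!: inj_onI dest: sub_mod_right_cancel)
  have "S x y < a + r" if "x < a" "y < a" for x y
    using that lt[of x "q x y"] q[of x y] by (auto simp: S_def)
  then have "incomplete_latin_square a r S"
    unfolding incomplete_latin_square_def
    using row1 row2 col col2 lt by (auto simp: S_def)
  then show ?thesis by blast
qed


section \<open>Cell designs\<close>

text \<open>The maps \<open>P\<close>, \<open>W\<close>, \<open>J\<close>, \<open>L\<close> send the cell \<open>(t, u)\<close> to \<open>p\<close>, \<open>w\<close>, \<open>j\<close>, \<open>l\<close>.\<close>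

definition cell_design ::
  "nat \<Rightarrow> nat \<Rightarrow> nat \<Rightarrow> (nat \<times> nat \<Rightarrow> nat \<times> nat \<Rightarrow> nat) \<Rightarrow> (nat \<times> nat \<Rightarrow> nat \<times> nat \<Rightarrow> nat) \<Rightarrow>
   (nat \<times> nat \<Rightarrow> nat \<times> nat \<Rightarrow> nat) \<Rightarrow> (nat \<times> nat \<Rightarrow> nat \<times> nat \<Rightarrow> nat) \<Rightarrow> bool" where
  "cell_design a b c P W J L \<longleftrightarrow>
    (let T = {..<a} \<times> {..<b}; U = {..<c} \<times> {..<a} in
     (\<forall>t\<in>T. \<forall>u\<in>U. P t u < a \<and> W t u < a \<and> J t u < b \<and> L t u < c) \<and>
     (\<forall>t\<in>T. \<forall>t'\<in>T. \<forall>u\<in>U. \<forall>u'\<in>U.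
        P t u = P t' u' \<longrightarrow> W t u = W t' u' \<longrightarrow> J t u = J t' u' \<longrightarrow> L t u = L t' u' \<longrightarrow>
        t = t' \<and> u = u') \<and>
     (\<forall>t\<in>T. \<forall>u\<in>U. \<forall>u'\<in>U.
        L t u = L t u' \<longrightarrow> P t u = P t u' \<and> (W t u = W t u' \<longrightarrow> u = u')) \<and>
     (\<forall>t\<in>T. \<forall>t'\<in>T. \<forall>u\<in>U.
        J t u = J t' u \<longrightarrow> P t u = P t' u \<and> (W t u = W t' u \<longrightarrow> t = t')))"

lemma cell_designD:
  assumes "cell_design a b c P W J L"
  shows "\<And>t u. t \<in> {..<a} \<times> {..<b} \<Longrightarrow> u \<in> {..<c} \<times> {..<a} \<Longrightarrow>
      P t u < a \<and> W t u < a \<and> J t u < b \<and> L t u < c"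
    and "\<And>t t' u u'. t \<in> {..<a} \<times> {..<b} \<Longrightarrow> t' \<in> {..<a} \<times> {..<b} \<Longrightarrow>
      u \<in> {..<c} \<times> {..<a} \<Longrightarrow> u' \<in> {..<c} \<times> {..<a} \<Longrightarrow>
      P t u = P t' u' \<Longrightarrow> W t u = W t' u' \<Longrightarrow> J t u = J t' u' \<Longrightarrow> L t u = L t' u' \<Longrightarrow>
      t = t' \<and> u = u'"
    and "\<And>t u u'. t \<in> {..<a} \<times> {..<b} \<Longrightarrow> u \<in> {..<c} \<times> {..<a} \<Longrightarrow> u' \<in> {..<c} \<times> {..<a} \<Longrightarrow>
      L t u = L t u' \<Longrightarrow> P t u = P t u' \<and> (W t u = W t u' \<longrightarrow> u = u')"
    and "\<And>t t' u. t \<in> {..<a} \<times> {..<b} \<Longrightarrow> t' \<in> {..<a} \<times> {..<b} \<Longrightarrow> u \<in> {..<c} \<times> {..<a} \<Longrightarrow>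
      J t u = J t' u \<Longrightarrow> P t u = P t' u \<and> (W t u = W t' u \<longrightarrow> t = t')"
  using assms unfolding cell_design_def Let_def by blast+

lemma cell_designI:
  assumes "\<And>t u. t \<in> {..<a} \<times> {..<b} \<Longrightarrow> u \<in> {..<c} \<times> {..<a} \<Longrightarrow>
      P t u < a \<and> W t u < a \<and> J t u < b \<and> L t u < c"
    and "\<And>t t' u u'. t \<in> {..<a} \<times> {..<b} \<Longrightarrow> t' \<in> {..<a} \<times> {..<b} \<Longrightarrow>
      u \<in> {..<c} \<times> {..<a} \<Longrightarrow> u' \<in> {..<c} \<times> {..<a} \<Longrightarrow>
      P t u = P t' u' \<Longrightarrow> W t u = W t' u' \<Longrightarrow> J t u = J t' u' \<Longrightarrow> L t u = L t' u' \<Longrightarrow>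
      t = t' \<and> u = u'"
    and "\<And>t u u'. t \<in> {..<a} \<times> {..<b} \<Longrightarrow> u \<in> {..<c} \<times> {..<a} \<Longrightarrow> u' \<in> {..<c} \<times> {..<a} \<Longrightarrow>
      L t u = L t u' \<Longrightarrow> P t u = P t u' \<and> (W t u = W t u' \<longrightarrow> u = u')"
    and "\<And>t t' u. t \<in> {..<a} \<times> {..<b} \<Longrightarrow> t' \<in> {..<a} \<times> {..<b} \<Longrightarrow> u \<in> {..<c} \<times> {..<a} \<Longrightarrow>
      J t u = J t' u \<Longrightarrow> P t u = P t' u \<and> (W t u = W t' u \<longrightarrow> t = t')"
  shows "cell_design a b c P W J L"
  unfolding cell_design_def Let_def
  by (intro conjI; intro ballI impI; rule assms; assumption)

text \<open>The values of \<open>t\<close> and of \<open>J\<close> are split in parallel, so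
  \<open>J''\<close> reveals the block and a comparison at equal \<open>J''\<close> stays within one
  design.\<close>

lemma cell_design_add:
  assumes 1: "cell_design a b c P W J L" and 2: "cell_design a b' c P' W' J' L'"
  shows "\<exists>P W J L. cell_design a (b + b') c P W J L"
proof -
  define low where "low = (\<lambda>t::nat \<times> nat. snd t < b)"
  define sh where "sh = (\<lambda>t::nat \<times> nat. (fst t, snd t - b))"
  define P'' where "P'' = (\<lambda>t u. if low t then P t u else P' (sh t) u)"
  define W'' where "W'' = (\<lambda>t u. if low t then W t u else W' (sh t) u)"
  define L'' where "L'' = (\<lambda>t u. if low t then L t u else L' (sh t) u)"
  define J'' where "J'' = (\<lambda>t u. if low t then J t u else b + J' (sh t) u)"
  let ?T = "{..<a} \<times> {..<b + b'}" and ?U = "{..<c} \<times> {..<a}"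
  have low: "t \<in> {..<a} \<times> {..<b}" if "t \<in> ?T" "low t" for t
    using that by (auto simp: low_def)
  have high: "sh t \<in> {..<a} \<times> {..<b'}" if "t \<in> ?T" "\<not> low t" for t
    using that by (auto simp: low_def sh_def)
  have sh: "t = t'" if "sh t = sh t'" "\<not> low t" "\<not> low t'" for t t'
    using that by (auto simp: low_def sh_def prod_eq_iff)
  note defs = P''_def W''_def J''_def L''_def
  have low_J: "low t \<longleftrightarrow> J'' t u < b" if "t \<in> ?T" "u \<in> ?U" for t u
    using cell_designD(1)[OF 1 low[OF that(1)] that(2)] by (auto simp: J''_def)
  have range: "P'' t u < a \<and> W'' t u < a \<and> J'' t u < b + b' \<and> L'' t u < c"
    if "t \<in> ?T" "u \<in> ?U" for t u
    using cell_designD(1)[OF 1 low[OF that(1)] that(2)]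
      cell_designD(1)[OF 2 high[OF that(1)] that(2)] by (cases "low t") (auto simp: defs)
  have inj: "t = t' \<and> u = u'"
    if tu: "t \<in> ?T" "t' \<in> ?T" "u \<in> ?U" "u' \<in> ?U"
      and eq: "P'' t u = P'' t' u'" "W'' t u = W'' t' u'" "J'' t u = J'' t' u'" "L'' t u = L'' t' u'"
    for t t' u u'
  proof -
    have same: "low t \<longleftrightarrow> low t'" using low_J tu eq(3) by metis
    show ?thesis
    proof (cases "low t")
      case True
      with same eq have "P t u = P t' u'" "W t u = W t' u'" "J t u = J t' u'" "L t u = L t' u'"
        by (simp_all add: defs)
      with cell_designD(2)[OF 1] low tu True same show ?thesis by blast
    next
      case False
      with same eq have "P' (sh t) u = P' (sh t') u'" "W' (sh t) u = W' (sh t') u'"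
        "J' (sh t) u = J' (sh t') u'" "L' (sh t) u = L' (sh t') u'"
        by (simp_all add: defs)
      with cell_designD(2)[OF 2] high tu False same have "sh t = sh t' \<and> u = u'" by blast
      with sh False same show ?thesis by blast
    qed
  qed
  have row: "P'' t u = P'' t u' \<and> (W'' t u = W'' t u' \<longrightarrow> u = u')"
    if tu: "t \<in> ?T" "u \<in> ?U" "u' \<in> ?U" and eq: "L'' t u = L'' t u'" for t u u'
  proof (cases "low t")
    case True
    with eq have "L t u = L t u'" by (simp add: defs)
    with cell_designD(3)[OF 1 low[OF tu(1) True] tu(2,3)] True show ?thesis
      by (simp add: defs)
  next
    case False
    with eq have "L' (sh t) u = L' (sh t) u'" by (simp add: defs)
    with cell_designD(3)[OF 2 high[OF tu(1) False] tu(2,3)] False show ?thesis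
      by (simp add: defs)
  qed
  have col: "P'' t u = P'' t' u \<and> (W'' t u = W'' t' u \<longrightarrow> t = t')"
    if tu: "t \<in> ?T" "t' \<in> ?T" "u \<in> ?U" and eq: "J'' t u = J'' t' u" for t t' u
  proof -
    have same: "low t \<longleftrightarrow> low t'" using low_J tu eq by metis
    show ?thesis
    proof (cases "low t")
      case True
      with same eq have "J t u = J t' u" by (simp add: defs)
      with cell_designD(4)[OF 1] low tu True same
      have "P t u = P t' u \<and> (W t u = W t' u \<longrightarrow> t = t')" by blast
      with True same show ?thesis by (simp add: defs)
    next
      case False
      with same eq have "J' (sh t) u = J' (sh t') u" by (simp add: defs)
      with cell_designD(4)[OF 2] high tu False same
      have "P' (sh t) u = P' (sh t') u \<and> (W' (sh t) u = W' (sh t') u \<longrightarrow> sh t = sh t')"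
        by blast
      with False same sh show ?thesis by (auto simp: defs)
    qed
  qed
  have "cell_design a (b + b') c P'' W'' J'' L''"
    by (rule cell_designI) (fact range inj row col)+
  then show ?thesis by blast
qed

text \<open>For odd \<open>c\<close> two coordinates cannot alternate around a cycle of length \<open>c\<close>, so the sum serves
  once as a third one.\<close>

lemma cyclic_coordinates_exist:
  assumes "0 < a" "2 \<le> c"
  shows "\<exists>f :: nat \<Rightarrow> nat \<times> nat \<Rightarrow> nat.
    (\<forall>k<c. \<forall>g \<in> {..<a} \<times> {..<a}. f k g < a) \<and>
    (\<forall>k<c. inj_on (\<lambda>g. (f k g, f (Suc k mod c) g)) ({..<a} \<times> {..<a}))"
proof -
  define f :: "nat \<Rightarrow> nat \<times> nat \<Rightarrow> nat" where
    "f = (\<lambda>k g. if odd c \<and> Suc k = c then (fst g + snd g) mod a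
                else if even k then fst g else snd g)"
  have inj: "inj_on (\<lambda>g. (f k g, f (Suc k mod c) g)) ({..<a} \<times> {..<a})" if k: "k < c" for k
  proof -
    consider "even c" "Suc k = c" | "odd c" "Suc k = c" | "odd c" "Suc (Suc k) = c"
      | "Suc (Suc k) < c" | "even c" "Suc (Suc k) = c"
      using k by linarith
    then show ?thesis
    proof cases
      case 2
      then show ?thesis using assms(2)
        by (auto simp: f_def inj_on_def) (metis add.commute add_mod_cancel)
    next
      case 3
      then show ?thesis
        by (auto simp: f_def inj_on_def) (metis add_mod_cancel)
    qed (use assms in \<open>auto simp: f_def inj_on_def\<close>)
  qed
  have "f k g < a" if "g \<in> {..<a} \<times> {..<a}" for k g
    using that assms(1) by (auto simp: f_def)
  with inj show ?thesis by blast
qed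

lemma cell_design_exists_aux:
  assumes "0 < a" "r \<le> a" "2 \<le> c"
  shows "\<exists>P W J L. cell_design a (a + r) c P W J L"
proof -
  obtain S where S: "incomplete_latin_square a r S"
    using incomplete_latin_square_exists assms(1,2) by blast
  have S1: "\<And>x y. x < a \<Longrightarrow> y < a \<Longrightarrow> S x y < a + r"
    and S2: "\<And>x y. x < a \<Longrightarrow> a \<le> y \<Longrightarrow> y < a + r \<Longrightarrow> S x y < a"
    and S3: "\<And>x y. a \<le> x \<Longrightarrow> x < a + r \<Longrightarrow> y < a \<Longrightarrow> S x y < a"
    using S unfolding incomplete_latin_square_def by blast+
  have row1: "inj_on (S x) {..<a + r}" if "x < a" for x
    using that S unfolding incomplete_latin_square_def by blast
  have row2: "inj_on (S x) {..<a}" if "a \<le> x" "x < a + r" for x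
    using that S unfolding incomplete_latin_square_def by blast
  have col1: "inj_on (\<lambda>x. S x y) {..<a + r}" if "y < a" for y
    using that S unfolding incomplete_latin_square_def by blast
  have col2: "inj_on (\<lambda>x. S x y) {..<a}" if "a \<le> y" "y < a + r" for y
    using that S unfolding incomplete_latin_square_def by blast
  have rowS: "y = y'" if "S x y = S x y'" "x < a + r" "y < a + r" "y' < a + r"
    "a \<le> x \<Longrightarrow> y < a \<and> y' < a" for x y y'
    using that inj_onD[OF row1[of x], of y y'] inj_onD[OF row2[of x], of y y']
    by (cases "x < a") auto
  have colS: "x = x'" if "S x y = S x' y" "x < a + r" "x' < a + r" "y < a + r"
    "a \<le> y \<Longrightarrow> x < a \<and> x' < a" for x x' y
    using that inj_onD[OF col1[of y], of x x'] inj_onD[OF col2[of y], of x x']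
    by (cases "y < a") auto
  obtain f :: "nat \<Rightarrow> nat \<times> nat \<Rightarrow> nat"
    where f: "\<forall>k<c. \<forall>g \<in> {..<a} \<times> {..<a}. f k g < a"
      and f_inj: "\<forall>k<c. inj_on (\<lambda>g. (f k g, f (Suc k mod c) g)) ({..<a} \<times> {..<a})"
    using cyclic_coordinates_exist[OF assms(1,3)] by (elim exE conjE)
  let ?T = "{..<a} \<times> {..<a + r}" and ?U = "{..<c} \<times> {..<a}"
  define nx where "nx k = Suc k mod c" for k
  have nx: "nx k < c" for k using assms(3) by (simp add: nx_def)
  have nx_inj: "k = k'" if "nx k = nx k'" "k < c" "k' < c" for k k'
    using that by (auto simp: nx_def mod_Suc split: if_splits)
  \<comment> \<open>In the \<open>k\<close>-th parallel class the point \<open>t\<close> lies on line \<open>p k t\<close> at position \<open>v k t\<close>, where the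
    position is the index of its line in the next class, or at least \<open>a\<close> for an extra point.\<close>
  define p where "p k t = (if snd t < a then f k t else fst t)" for k and t :: "nat \<times> nat"
  define v where "v k t = (if snd t < a then f (nx k) t else snd t)" for k and t :: "nat \<times> nat"
  have p: "p k t < a" and v: "v k t < a + r" if "k < c" "t \<in> ?T" for k t
    using that f nx[of k] by (auto simp: p_def v_def intro: trans_less_add1)
  have v_less: "v k t < a \<longleftrightarrow> snd t < a" if "k < c" "t \<in> ?T" for k t
    using that f nx[of k] by (auto simp: v_def)
  have p_nx: "p (nx k) t = v k t" if "v k t < a" "k < c" "t \<in> ?T" for k t
    using v_less that by (simp add: p_def v_def)
  have pv_inj: "t = t'" if "p k t = p k t'" "v k t = v k t'" "k < c" "t \<in> ?T" "t' \<in> ?T" for k t t'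
  proof (cases "snd t < a")
    case True
    then have "snd t' < a" using v_less that by metis
    with True that inj_onD[OF f_inj[rule_format, OF that(3)], of t t'] show ?thesis
      by (auto simp: p_def v_def nx_def)
  next
    case False
    then have "\<not> snd t' < a" using v_less that by metis
    with False that show ?thesis by (auto simp: p_def v_def prod_eq_iff)
  qed
  \<comment> \<open>In column \<open>(k, m)\<close>, row \<open>m\<close> of \<open>S\<close> marks
    by symbols at least \<open>a\<close> the \<open>r\<close> lines of the next class that are taken
    whole; all other points stay on their line of class \<open>k\<close>.\<close>
  define main where "main t u \<longleftrightarrow> S (snd u) (v (fst u) t) < a" for t and u :: "nat \<times> nat"
  define P where "P t u = (if main t u then p (fst u) t else v (fst u) t)" for t u
  define L where "L t u = (if main t u then fst u else nx (fst u))" for t u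
  \<comment> \<open>The shift by \<open>snd u\<close> makes the first case an addition table:
    \<open>J\<close> with \<open>u\<close> gives the line, \<open>J\<close> with the line gives
    \<open>snd u\<close>.\<close>
  define J where "J t u = (if main t u then (p (fst u) t + snd u) mod a else S (snd u) (v (fst u) t))"
    for t u
  \<comment> \<open>On a full line the symbol, being at least \<open>a\<close>, is reused as a row
    index of \<open>S\<close>; that row numbers the \<open>a\<close> points of the line.\<close>
  define W where "W t u = (if main t u then S (snd u) (v (fst u) t)
     else S (S (snd u) (v (fst u) t)) (v (nx (fst u)) t))" for t u
  \<comment> \<open>In rows below \<open>a\<close>, columns from \<open>a\<close> on hold only
    symbols below \<open>a\<close>; so extra points are always \<open>main\<close>.\<close>
  have slot: "v (fst u) t < a" "v (nx (fst u)) t < a" "S (snd u) (v (fst u) t) < a + r"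
    "a \<le> S (snd u) (v (fst u) t)" "p (nx (fst u)) t = v (fst u) t"
    if "t \<in> ?T" "u \<in> ?U" "\<not> main t u" for t u
  proof -
    have u: "fst u < c" "snd u < a" using that by auto
    show 1: "v (fst u) t < a"
      using S2[OF u(2) _ v[OF u(1) that(1)]] that(3) unfolding main_def by force
    then show "v (nx (fst u)) t < a" using v_less nx u that(1) by metis
    show "S (snd u) (v (fst u) t) < a + r" using S1 u 1 by blast
    show "a \<le> S (snd u) (v (fst u) t)" using that(3) by (simp add: main_def)
    show "p (nx (fst u)) t = v (fst u) t" using p_nx 1 u that(1) by blast
  qed
  have J_main: "main t u \<longleftrightarrow> J t u < a" if "t \<in> ?T" "u \<in> ?U" for t u
    using slot(4)[OF that] assms(1) by (auto simp: J_def)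
  have range: "P t u < a \<and> W t u < a \<and> J t u < a + r \<and> L t u < c" if "t \<in> ?T" "u \<in> ?U" for t u
  proof (cases "main t u")
    case True
    then show ?thesis using that p[of "fst u" t] assms(1)
      by (auto simp: P_def W_def J_def L_def main_def intro: trans_less_add1)
  next
    case False
    then show ?thesis using slot[OF that False] S3 nx
      by (auto simp: P_def W_def J_def L_def)
  qed
  have P_eq: "P t u = p (L t u) t" if "t \<in> ?T" "u \<in> ?U" for t u
    using slot(5)[OF that] by (simp add: P_def L_def)
  \<comment> \<open>The row of the incomplete square used in the cell: the formula for \<open>W\<close> becomes uniform.\<close>
  define i where "i t u = (if main t u then snd u else S (snd u) (v (fst u) t))" for t u
  have i: "i t u < a + r" if "t \<in> ?T" "u \<in> ?U" for t u
    using slot[OF that] that by (auto simp: i_def)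
  have W_eq: "W t u = S (i t u) (v (L t u) t)" for t u
    by (simp add: W_def i_def L_def)
  have i_main: "main t u \<longleftrightarrow> i t u < a" if "t \<in> ?T" "u \<in> ?U" for t u
    using slot(4)[OF that] that by (auto simp: i_def)
  have i_v: "i t u < a" if "a \<le> v (L t u) t" "t \<in> ?T" "u \<in> ?U" for t u
    using that slot[OF that(2,3)] by (auto simp: i_def L_def)
  have i_eqD: "u = u'" if tu: "t \<in> ?T" "u \<in> ?U" "u' \<in> ?U" and "L t u = L t u'" "i t u = i t u'"
    for t u u'
  proof -
    have same: "main t u \<longleftrightarrow> main t u'" using i_main that by metis
    have u: "fst u < c" "fst u' < c" "snd u < a" "snd u' < a" using tu by auto
    have fst: "fst u = fst u'" using that(4) same u nx_inj by (auto simp: L_def split: if_splits)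
    moreover have "snd u = snd u'"
    proof (cases "main t u")
      case True
      then show ?thesis using that(5) same by (simp add: i_def)
    next
      case False
      then have "S (snd u) (v (fst u) t) = S (snd u') (v (fst u) t)"
        using that(5) same fst by (simp add: i_def)
      then show ?thesis by (rule colS) (use u v[OF u(1) tu(1)] in auto)
    qed
    ultimately show ?thesis by (simp add: prod_eq_iff)
  qed
  have L_less: "L t u < c" if "t \<in> ?T" "u \<in> ?U" for t u using range that by blast
  have row: "P t u = P t u' \<and> (W t u = W t u' \<longrightarrow> u = u')"
    if tu: "t \<in> ?T" "u \<in> ?U" "u' \<in> ?U" and L: "L t u = L t u'" for t u u'
  proof -
    have "u = u'" if "W t u = W t u'"
    proof -
      \<comment> \<open>For fixed \<open>t\<close> and \<open>L\<close>, \<open>W\<close> runs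
        through one column of \<open>S\<close> with rows indexed by \<open>i\<close>; at an extra
        point \<open>i_v\<close> keeps it out of the hole.\<close>
      have "i t u = i t u'"
        by (rule colS[of _ "v (L t u) t"])
          (use that L W_eq i tu v L_less i_v in auto)
      then show ?thesis using i_eqD tu L by blast
    qed
    then show ?thesis using P_eq tu L by simp
  qed
  have J_i: "J t u = (if i t u < a then (P t u + i t u) mod a else i t u)"
    if "t \<in> ?T" "u \<in> ?U" for t u
    using i_main[OF that] by (auto simp: J_def i_def P_def)
  have Wt: "t = t'"
    if tu: "t \<in> ?T" "t' \<in> ?T" "u \<in> ?U" "u' \<in> ?U"
      and eq: "P t u = P t' u'" "W t u = W t' u'" "i t u = i t' u'" "L t u = L t' u'" for t t' u u'
  proof -
    \<comment> \<open>Dually, for fixed \<open>i\<close> and \<open>L\<close>, \<open>W\<close> lies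
      in one row of \<open>S\<close> and gives the position; line and position give the
      point.\<close>
    have "v (L t u) t = v (L t u) t'"
    proof (rule rowS[of "i t u"])
      show "S (i t u) (v (L t u) t) = S (i t u) (v (L t u) t')" using eq(2)
        by (simp add: W_eq flip: eq(3,4))
      show "v (L t u) t < a + r" "v (L t u) t' < a + r" 
        using v[OF L_less[OF tu(1,3)]] tu(1,2) by simp_all
      show "i t u < a + r" by (rule i[OF tu(1,3)])
      assume "a \<le> i t u"
      then have "\<not> main t u" "\<not> main t' u'" using i_main tu eq(3) by auto
      then show "v (L t u) t < a \<and> v (L t u) t' < a"
        using slot(2)[OF tu(1,3)] slot(2)[OF tu(2,4)] eq(4) by (simp add: L_def)
    qed
    moreover have "p (L t u) t = p (L t u) t'" using eq P_eq[OF tu(1,3)] P_eq[OF tu(2,4)] by simp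
    ultimately show ?thesis using pv_inj[OF _ _ L_less[OF tu(1,3)] tu(1,2)] by simp
  qed
  have i_J: "i t u = i t' u'" if tu: "t \<in> ?T" "t' \<in> ?T" "u \<in> ?U" "u' \<in> ?U"
      and eq: "P t u = P t' u'" "J t u = J t' u'" for t t' u u'
  proof (cases "J t u < a")
    case True
    then have "i t u < a" "i t' u' < a"
      using J_main[OF tu(1,3)] J_main[OF tu(2,4)] i_main[OF tu(1,3)] i_main[OF tu(2,4)] eq by auto
    then show ?thesis using J_i[OF tu(1,3)] J_i[OF tu(2,4)] eq
        add_mod_cancel[of "i t u" "P t u" a "i t' u'"] by (simp add: add.commute)
  next
    case False
    then have "\<not> i t u < a" "\<not> i t' u' < a"
      using J_main[OF tu(1,3)] J_main[OF tu(2,4)] i_main[OF tu(1,3)] i_main[OF tu(2,4)] eq by auto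
    then show ?thesis using J_i[OF tu(1,3)] J_i[OF tu(2,4)] eq by simp
  qed
  have inj: "t = t' \<and> u = u'"
    if tu: "t \<in> ?T" "t' \<in> ?T" "u \<in> ?U" "u' \<in> ?U"
      and eq: "P t u = P t' u'" "W t u = W t' u'" "J t u = J t' u'" "L t u = L t' u'" for t t' u u'
  proof -
    have i_eq: "i t u = i t' u'" by (rule i_J[OF tu eq(1,3)])
    have t: "t = t'" by (rule Wt[OF tu eq(1,2) i_eq eq(4)])
    with i_eqD[OF tu(1,3,4)] i_eq eq(4) show ?thesis by simp
  qed
  have col: "P t u = P t' u \<and> (W t u = W t' u \<longrightarrow> t = t')"
    if tu: "t \<in> ?T" "t' \<in> ?T" "u \<in> ?U" and eq: "J t u = J t' u" for t t' u
  proof -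
    have u: "fst u < c" "snd u < a" using tu by auto
    have same: "main t u \<longleftrightarrow> main t' u" using J_main[OF tu(1,3)] J_main[OF tu(2,3)] eq by simp
    then have L: "L t u = L t' u" by (simp add: L_def)
    have P: "P t u = P t' u"
    proof (cases "main t u")
      case True
      then have "(p (fst u) t + snd u) mod a = (p (fst u) t' + snd u) mod a"
        using eq same by (simp add: J_def)
      then have "p (fst u) t = p (fst u) t'"
        by (rule add_mod_cancel) (use p u tu in auto)
      then show ?thesis using True same by (simp add: P_def)
    next
      case False
      then have "S (snd u) (v (fst u) t) = S (snd u) (v (fst u) t')" using eq same
        by (simp add: J_def)
      then have "v (fst u) t = v (fst u) t'"
        by (rule rowS) (use u v[OF u(1) tu(1)] v[OF u(1) tu(2)] in auto)
      then show ?thesis using False same by (simp add: P_def)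
    qed
    with Wt[OF tu(1,2,3,3) P _ i_J[OF tu(1,2,3,3) P eq] L] show ?thesis by blast
  qed
  have "cell_design a (a + r) c P W J L"
    by (rule cell_designI) (fact range inj row col)+
  then show ?thesis by blast
qed

text \<open>Blocks of width \<open>a\<close>, the case \<open>r = 0\<close>, are split off until
  \<open>b \<le> 2 * a\<close>, when \<open>b - a\<close> is an admissible \<open>r\<close>.\<close>

lemma cell_design_exists:
  assumes "0 < a" "a \<le> b" "2 \<le> c"
  shows "\<exists>P W J L. cell_design a b c P W J L"
  using assms(2)
proof (induction b rule: less_induct)
  case (less b)
  show ?case
  proof (cases "b \<le> 2 * a")
    case True
    then show ?thesis using cell_design_exists_aux[OF assms(1) _ assms(3), of "b - a"] less.prems
      by simp
  next
    case False
    then have "\<exists>P W J L. cell_design a (b - a) c P W J L" using less.IH[of "b - a"] assms(1) by simp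
    moreover have "\<exists>P W J L. cell_design a a c P W J L"
      using cell_design_exists_aux[OF assms(1) _ assms(3), of 0] by simp
    ultimately have "\<exists>P W J L. cell_design a (b - a + a) c P W J L" using cell_design_add by blast
    then show ?thesis using less.prems by simp
  qed
qed

section \<open>The product construction\<close>

text \<open>Allows tuples as indices and symbols; injectivity suffices because all sets have
  \<open>n\<close> elements.\<close>

lemma MOLS_of_finite_sets:
  fixes F :: "nat \<Rightarrow> 'r \<Rightarrow> 'c \<Rightarrow> 's"
  assumes R: "finite R" "card R = n" and C: "finite C" "card C = n"
    and Y: "\<And>t. t < k \<Longrightarrow> finite (Y t) \<and> card (Y t) = n"
    and F: "\<And>t x y. t < k \<Longrightarrow> x \<in> R \<Longrightarrow> y \<in> C \<Longrightarrow> F t x y \<in> Y t"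
    and row: "\<And>t x y y'. t < k \<Longrightarrow> x \<in> R \<Longrightarrow> y \<in> C \<Longrightarrow> y' \<in> C \<Longrightarrow> F t x y = F t x y' \<Longrightarrow> y = y'"
    and col: "\<And>t x x' y. t < k \<Longrightarrow> x \<in> R \<Longrightarrow> x' \<in> R \<Longrightarrow> y \<in> C \<Longrightarrow> F t x y = F t x' y \<Longrightarrow> x = x'"
    and orth: "\<And>s t x x' y y'. s < k \<Longrightarrow> t < k \<Longrightarrow> s \<noteq> t \<Longrightarrow> x \<in> R \<Longrightarrow> x' \<in> R \<Longrightarrow>
      y \<in> C \<Longrightarrow> y' \<in> C \<Longrightarrow> F s x y = F s x' y' \<Longrightarrow> F t x y = F t x' y' \<Longrightarrow> x = x' \<and> y = y'"
  shows "\<exists>G. MOLS n k G"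
proof -
  obtain \<rho> where \<rho>: "bij_betw \<rho> {..<n} R"
    using ex_bij_betw_nat_finite[OF R(1)] R(2) by (auto simp: atLeast0LessThan)
  obtain \<kappa> where \<kappa>: "bij_betw \<kappa> {..<n} C"
    using ex_bij_betw_nat_finite[OF C(1)] C(2) by (auto simp: atLeast0LessThan)
  have "\<exists>h. bij_betw h (Y t) {..<n}" if "t < k" for t
    using ex_bij_betw_finite_nat[of "Y t"] Y[OF that] by (auto simp: atLeast0LessThan)
  then obtain \<eta> where \<eta>: "\<And>t. t < k \<Longrightarrow> bij_betw (\<eta> t) (Y t) {..<n}" by metis
  define G where "G t i j = \<eta> t (F t (\<rho> i) (\<kappa> j))" for t i j
  have \<rho>R: "\<rho> i \<in> R" and \<kappa>C: "\<kappa> i \<in> C" if "i < n" for i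
    using that \<rho> \<kappa> by (auto simp: bij_betw_def)
  have \<rho>_eq: "i = j" if "\<rho> i = \<rho> j" "i < n" "j < n" for i j
    using that \<rho> by (auto simp: bij_betw_def dest: inj_onD)
  have \<kappa>_eq: "i = j" if "\<kappa> i = \<kappa> j" "i < n" "j < n" for i j
    using that \<kappa> by (auto simp: bij_betw_def dest: inj_onD)
  have G_less: "G t i j < n" if "t < k" "i < n" "j < n" for t i j
    using bij_betwE[OF \<eta>[OF that(1)]] F[OF that(1) \<rho>R[OF that(2)] \<kappa>C[OF that(3)]]
    by (simp add: G_def)
  have G_eq: "F t (\<rho> i) (\<kappa> j) = F t (\<rho> i') (\<kappa> j')"
    if "G t i j = G t i' j'" "t < k" "i < n" "j < n" "i' < n" "j' < n" for t i j i' j'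
    by (rule inj_onD[OF bij_betw_imp_inj_on[OF \<eta>[OF that(2)]] that(1)[unfolded G_def]
          F[OF that(2) \<rho>R[OF that(3)] \<kappa>C[OF that(4)]]
          F[OF that(2) \<rho>R[OF that(5)] \<kappa>C[OF that(6)]]])
  have "latin_square n (G t)" if t: "t < k" for t
    unfolding latin_square_def
  proof (intro exI[of _ "{..<n}"] conjI allI impI)
    fix i assume i: "i < n"
    have "j = j'" if "G t i j = G t i j'" "j < n" "j' < n" for j j'
      using row[OF t \<rho>R[OF i] \<kappa>C[OF that(2)] \<kappa>C[OF that(3)] G_eq[OF that(1) t i that(2) i that(3)]]
        \<kappa>_eq that(2,3) by simp
    then have "inj_on (\<lambda>j. G t i j) {..<n}" by (auto intro: inj_onI)
    moreover have "(\<lambda>j. G t i j) ` {..<n} \<subseteq> {..<n}" using G_less t i by auto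
    ultimately show "bij_betw (\<lambda>j. G t i j) {..<n} {..<n}"
      by (simp add: bij_betw_def endo_inj_surj)
  next
    fix j assume j: "j < n"
    have "i = i'" if "G t i j = G t i' j" "i < n" "i' < n" for i i'
      using col[OF t \<rho>R[OF that(2)] \<rho>R[OF that(3)] \<kappa>C[OF j] G_eq[OF that(1) t that(2) j that(3) j]]
        \<rho>_eq that(2,3) by simp
    then have "inj_on (\<lambda>i. G t i j) {..<n}" by (auto intro: inj_onI)
    moreover have "(\<lambda>i. G t i j) ` {..<n} \<subseteq> {..<n}" using G_less t j by auto
    ultimately show "bij_betw (\<lambda>i. G t i j) {..<n} {..<n}"
      by (simp add: bij_betw_def endo_inj_surj)
  qed auto
  moreover have "orthogonal_squares n (G s) (G t)" if st: "s < k" "t < k" "s \<noteq> t" for s t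
  proof -
    have "i = i' \<and> j = j'" if ij: "i < n" "j < n" "i' < n" "j' < n"
      and eq: "G s i j = G s i' j'" "G t i j = G t i' j'" for i j i' j'
      using orth[OF st \<rho>R[OF ij(1)] \<rho>R[OF ij(3)] \<kappa>C[OF ij(2)] \<kappa>C[OF ij(4)]
          G_eq[OF eq(1) st(1) ij] G_eq[OF eq(2) st(2) ij]] \<rho>_eq \<kappa>_eq ij by blast
    then show ?thesis unfolding orthogonal_squares_def by (auto intro!: inj_onI)
  qed
  ultimately have "MOLS n k G" unfolding MOLS_def by blast
  then show ?thesis by blast
qed

lemma MOLS_symbols:
  assumes "MOLS n k F" "t < k"
  shows "\<exists>S. finite S \<and> card S = n \<and> (\<forall>i<n. \<forall>j<n. F t i j \<in> S)"
proof -
  obtain S where "finite S" "card S = n" "\<forall>i<n. bij_betw (\<lambda>j. F t i j) {..<n} S"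
    using assms unfolding MOLS_def latin_square_def by blast
  then show ?thesis by (intro exI[of _ S]) (auto dest: bij_betwE)
qed

lemma MOLS_row_eqD:
  assumes "MOLS n k F" "t < k" "F t i j = F t i j'" "i < n" "j < n" "j' < n"
  shows "j = j'"
proof -
  have "inj_on (\<lambda>j. F t i j) {..<n}"
    using assms(1,2,4) unfolding MOLS_def latin_square_def bij_betw_def by blast
  then show ?thesis using inj_onD assms(3,5,6) by fastforce
qed

lemma MOLS_col_eqD:
  assumes "MOLS n k F" "t < k" "F t i j = F t i' j" "j < n" "i < n" "i' < n"
  shows "i = i'"
proof -
  have "inj_on (\<lambda>i. F t i j) {..<n}"
    using assms(1,2,4) unfolding MOLS_def latin_square_def bij_betw_def by blast
  then show ?thesis using inj_onD assms(3,5,6) by fastforce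
qed

lemma MOLS_orthogonalD:
  assumes "MOLS n k F" "s < k" "t < k" "s \<noteq> t" "F s i j = F s i' j'" "F t i j = F t i' j'"
    "i < n" "j < n" "i' < n" "j' < n"
  shows "i = i' \<and> j = j'"
proof -
  have "inj_on (\<lambda>(i, j). (F s i j, F t i j)) ({..<n} \<times> {..<n})"
    using assms(1-4) unfolding MOLS_def orthogonal_squares_def by blast
  from inj_onD[OF this, of "(i, j)" "(i', j')"] show ?thesis using assms(5-10) by auto
qed

lemma MOLS_product:
  assumes D: "cell_design a b c P W J L"
    and A: "MOLS a k A" and B: "MOLS b (Suc k) B" and C: "MOLS c (Suc k) C"
  shows "\<exists>G. MOLS (a * b * c) (Suc k) G"
proof -
  \<comment> \<open>Index \<open>0\<close> yields the additional class: \<open>y\<close> alone is no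
    latin square for \<open>2 \<le> a\<close>, but with any \<open>A i\<close> it determines the
    cell, as columns of \<open>A i\<close> are injective.\<close>
  define X where "X i x y = (case i of 0 \<Rightarrow> y | Suc i \<Rightarrow> A i x y)" for i x y
  have X_sym: "\<exists>S. finite S \<and> card S = a \<and> (\<forall>x<a. \<forall>y<a. X i x y \<in> S)" if "i < Suc k" for i
  proof (cases i)
    case 0
    then show ?thesis by (intro exI[of _ "{..<a}"]) (simp add: X_def)
  next
    case (Suc j)
    then show ?thesis using MOLS_symbols[OF A, of j] that by (simp add: X_def)
  qed
  have X_row: "y = y'" if "i < Suc k" "X i x y = X i x y'" "x < a" "y < a" "y' < a" for i x y y'
    using that MOLS_row_eqD[OF A] by (auto simp: X_def split: nat.splits)
  have X_orth: "x = x' \<and> y = y'" if ij: "i < Suc k" "j < Suc k" "i \<noteq> j"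
      and eq: "X i x y = X i x' y'" "X j x y = X j x' y'"
      and lt: "x < a" "y < a" "x' < a" "y' < a" for i j x y x' y'
  proof (cases i)
    case 0
    then obtain j' where "j = Suc j'" "j' < k" using ij by (cases j) auto
    then show ?thesis using 0 eq lt MOLS_col_eqD[OF A, of j' x y x'] by (simp add: X_def)
  next
    case (Suc i')
    show ?thesis
    proof (cases j)
      case 0
      then show ?thesis using Suc eq lt ij MOLS_col_eqD[OF A, of i' x y x'] by (simp add: X_def)
    next
      case (Suc j')
      then show ?thesis using \<open>i = Suc i'\<close> eq lt ij MOLS_orthogonalD[OF A, of i' j' x y x' y']
        by (simp add: X_def)
    qed
  qed
  obtain SX where SX: "\<And>i. i < Suc k \<Longrightarrow> finite (SX i) \<and> card (SX i) = a \<and> (\<forall>x<a. \<forall>y<a. X i x y \<in> SX i)"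
    using X_sym by metis
  obtain SB where SB: "\<And>i. i < Suc k \<Longrightarrow> finite (SB i) \<and> card (SB i) = b \<and> (\<forall>x<b. \<forall>y<b. B i x y \<in> SB i)"
    using MOLS_symbols[OF B] by metis
  obtain SC where SC: "\<And>i. i < Suc k \<Longrightarrow> finite (SC i) \<and> card (SC i) = c \<and> (\<forall>x<c. \<forall>y<c. C i x y \<in> SC i)"
    using MOLS_symbols[OF C] by metis
  let ?T = "{..<a} \<times> {..<b}" and ?U = "{..<c} \<times> {..<a}"
  define F where "F i x y = (X i (P (fst x) (fst y)) (W (fst x) (fst y)),
      B i (J (fst x) (fst y)) (snd y), C i (snd x) (L (fst x) (fst y)))" for i x y
  have lt: "P t u < a" "W t u < a" "J t u < b" "L t u < c" if "t \<in> ?T" "u \<in> ?U" for t u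
    using cell_designD(1)[OF D that] by auto
  show ?thesis
  proof (rule MOLS_of_finite_sets[where R = "?T \<times> {..<c}" and C = "?U \<times> {..<b}" and F = F
        and Y = "\<lambda>i. SX i \<times> SB i \<times> SC i"])
    show "finite (?T \<times> {..<c})" "finite (?U \<times> {..<b})" by auto
    show "card (?T \<times> {..<c}) = a * b * c" "card (?U \<times> {..<b}) = a * b * c" by auto
    show "finite (SX i \<times> SB i \<times> SC i) \<and> card (SX i \<times> SB i \<times> SC i) = a * b * c"
      if "i < Suc k" for i
      using SX[OF that] SB[OF that] SC[OF that] by simp
  next
    fix i x y assume i: "i < Suc k" and x: "x \<in> ?T \<times> {..<c}" and y: "y \<in> ?U \<times> {..<b}"
    have xy: "fst x \<in> ?T" "fst y \<in> ?U" "snd x < c" "snd y < b" using x y by auto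
    show "F i x y \<in> SX i \<times> SB i \<times> SC i"
      using SX[OF i] SB[OF i] SC[OF i] lt[OF xy(1,2)] xy(3,4) by (simp add: F_def)
  next
    fix i x y y' assume i: "i < Suc k" and x: "x \<in> ?T \<times> {..<c}"
      and y: "y \<in> ?U \<times> {..<b}" and y': "y' \<in> ?U \<times> {..<b}" and eq: "F i x y = F i x y'"
    have xy: "fst x \<in> ?T" "fst y \<in> ?U" "fst y' \<in> ?U" "snd x < c" "snd y < b" "snd y' < b"
      using x y y' by auto
    note l = lt[OF xy(1,2)] and l' = lt[OF xy(1,3)]
    \<comment> \<open>The order of recovery: \<open>C\<close> gives \<open>L\<close>, hence
      \<open>P\<close>; then \<open>X\<close> gives \<open>W\<close>, hence \<open>fst y\<close>;
      only then \<open>B\<close> gives \<open>snd y\<close>. For columns \<open>B\<close> and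
      \<open>C\<close> change roles.\<close>
    have L: "L (fst x) (fst y) = L (fst x) (fst y')"
      using eq MOLS_row_eqD[OF C i _ xy(4) l(4) l'(4)] by (simp add: F_def)
    note PW = cell_designD(3)[OF D xy(1-3) L]
    have "W (fst x) (fst y) = W (fst x) (fst y')"
      using eq PW X_row[OF i _ l(1,2) l'(2)] by (simp add: F_def)
    with PW have "fst y = fst y'" by blast
    moreover from this have "snd y = snd y'"
      using eq MOLS_row_eqD[OF B i _ l(3) xy(5,6)] by (simp add: F_def)
    ultimately show "y = y'" by (simp add: prod_eq_iff)
  next
    fix i x x' y assume i: "i < Suc k" and x: "x \<in> ?T \<times> {..<c}"
      and x': "x' \<in> ?T \<times> {..<c}" and y: "y \<in> ?U \<times> {..<b}" and eq: "F i x y = F i x' y"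
    have xy: "fst x \<in> ?T" "fst x' \<in> ?T" "fst y \<in> ?U" "snd x < c" "snd x' < c" "snd y < b"
      using x x' y by auto
    note l = lt[OF xy(1,3)] and l' = lt[OF xy(2,3)]
    have J: "J (fst x) (fst y) = J (fst x') (fst y)"
      using eq MOLS_col_eqD[OF B i _ xy(6) l(3) l'(3)] by (simp add: F_def)
    note PW = cell_designD(4)[OF D xy(1-3) J]
    have "W (fst x) (fst y) = W (fst x') (fst y)"
      using eq PW X_row[OF i _ l(1,2) l'(2)] by (simp add: F_def)
    with PW have "fst x = fst x'" by blast
    moreover from this have "snd x = snd x'"
      using eq MOLS_col_eqD[OF C i _ l(4) xy(4,5)] by (simp add: F_def)
    ultimately show "x = x'" by (simp add: prod_eq_iff)
  next
    fix i j x x' y y' assume ij: "i < Suc k" "j < Suc k" "i \<noteq> j"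
      and x: "x \<in> ?T \<times> {..<c}" and x': "x' \<in> ?T \<times> {..<c}"
      and y: "y \<in> ?U \<times> {..<b}" and y': "y' \<in> ?U \<times> {..<b}"
      and eq: "F i x y = F i x' y'" "F j x y = F j x' y'"
    have xy: "fst x \<in> ?T" "fst x' \<in> ?T" "fst y \<in> ?U" "fst y' \<in> ?U"
      "snd x < c" "snd x' < c" "snd y < b" "snd y' < b"
      using x x' y y' by auto
    note l = lt[OF xy(1,3)] and l' = lt[OF xy(2,4)]
    have PW: "P (fst x) (fst y) = P (fst x') (fst y') \<and> W (fst x) (fst y) = W (fst x') (fst y')"
      using eq X_orth[OF ij _ _ l(1,2) l'(1,2)] by (simp add: F_def)
    have J: "J (fst x) (fst y) = J (fst x') (fst y') \<and> snd y = snd y'"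
      using eq MOLS_orthogonalD[OF B ij _ _ l(3) xy(7) l'(3) xy(8)] by (simp add: F_def)
    have L: "snd x = snd x' \<and> L (fst x) (fst y) = L (fst x') (fst y')"
      using eq MOLS_orthogonalD[OF C ij _ _ xy(5) l(4) xy(6) l'(4)] by (simp add: F_def)
    have "fst x = fst x' \<and> fst y = fst y'"
      using cell_designD(2)[OF D xy(1-4)] PW J L by blast
    then show "x = x' \<and> y = y'" using J L by (simp add: prod_eq_iff)
  qed
qed

section \<open>From families to the maximum\<close>

text \<open>Initial segments of a family are families, so every finite size up to the supremum
  occurs, even if the supremum is infinite.\<close>

lemma le_max_MOLS_iff: "enat k \<le> max_MOLS n \<longleftrightarrow> (\<exists>F. MOLS n k F)"
proof
  assume k: "enat k \<le> max_MOLS n"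
  show "\<exists>F. MOLS n k F"
  proof (cases k)
    case 0
    then show ?thesis by (simp add: MOLS_def)
  next
    case (Suc m)
    then have "enat m < Sup {enat k | k. \<exists>F. MOLS n k F}"
      using k unfolding max_MOLS_def by (meson enat_ord_simps(2) lessI less_le_trans)
    then obtain k' F where "m < k'" "MOLS n k' F" by (auto simp: less_Sup_iff)
    then have "MOLS n k F" using Suc by (simp add: MOLS_def)
    then show ?thesis by blast
  qed
next
  assume "\<exists>F. MOLS n k F"
  then show "enat k \<le> max_MOLS n" unfolding max_MOLS_def by (auto intro: Sup_upper)
qed

theorem theorem2p2:
  fixes a b c :: nat
  assumes "0 < a" and "0 < b" and "0 < c"
    and "a \<le> b" and "b \<le> c"
  shows "max_MOLS (a * b * c) \<ge> min (max_MOLS a + 1) (min (max_MOLS b) (max_MOLS c))"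
proof (cases "c = 1")
  case True
  then have "a * b * c = 1" using assms by simp
  then show ?thesis using max_MOLS_1 by simp
next
  case False
  with assms obtain P W J L where D: "cell_design a b c P W J L"
    using cell_design_exists[of a b c] by (metis One_nat_def Suc_leI le_neq_implies_less numeral_2_eq_2)
  have step: "enat k \<le> max_MOLS (a * b * c)"
    if "enat k \<le> min (max_MOLS a + 1) (min (max_MOLS b) (max_MOLS c))" for k
  proof (cases k)
    case 0
    then show ?thesis by (simp add: zero_enat_def[symmetric])
  next
    case (Suc m)
    have "enat m \<le> max_MOLS a"
      using that Suc by (cases "max_MOLS a") (auto simp: one_enat_def)
    then obtain A where "MOLS a m A" using le_max_MOLS_iff by blast
    moreover have "enat (Suc m) \<le> max_MOLS b" "enat (Suc m) \<le> max_MOLS c"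
      using that Suc by simp_all
    then obtain B C where "MOLS b (Suc m) B" "MOLS c (Suc m) C"
      unfolding le_max_MOLS_iff by blast
    ultimately have "\<exists>G. MOLS (a * b * c) (Suc m) G" by (intro MOLS_product[OF D])
    then show ?thesis by (simp add: Suc le_max_MOLS_iff)
  qed
  show ?thesis
  \<comment> \<open>The minimum may be infinite, so it cannot itself be put into
    \<open>step\<close>; a finite maximum \<open>k\<close> is refuted by
    \<open>Suc k\<close>.\<close>
  proof (rule ccontr)
    assume "\<not> ?thesis"
    then have less: "max_MOLS (a * b * c) < min (max_MOLS a + 1) (min (max_MOLS b) (max_MOLS c))"
      by (simp only: not_le)
    then obtain k where k: "max_MOLS (a * b * c) = enat k" by (cases "max_MOLS (a * b * c)") auto
    with less have "enat (Suc k) \<le> min (max_MOLS a + 1) (min (max_MOLS b) (max_MOLS c))"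
      by (metis Suc_ile_eq)
    from step[OF this] k show False by simp
  qed
qed

end
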